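(* Let $\mathcal{O},\mathcal{P}$ be smooth orbifolds with $\dim\mathcal{O}\ge\dim\mathcal{P}$. Let $(f,\{\tilde f_x\},\{\Theta_{f,x}\}):\mathcal{O}\to\mathcal{P}$ be a smooth complete orbifold map, let $p\in\mathcal{P}$ be a regular value of $f$, and let $\mathcal{S}=f^{-1}(p)$. Then for each $x\in\mathcal{S}$ there is a faithful representation of $N_x=\ker\Theta_{f,x}$ in $\Gamma_{x,\mathcal{S}}$, i.e. an injective group homomorphism $N_x\to\Gamma_{x,\mathcal{S}}$, where $\Gamma_{x,\mathcal{S}}$ is the isotropy group at $x$ of the full smooth suborbifold $\mathcal{S}$ of $\mathcal{O}$.
   Context: Smooth means $C^\infty$. Orbifold. An $n$-dimensional smooth orbifold $\mathcal{O}$ consists of a paracompact Hausdorff space $X_{\mathcal{O}}$ (the underlying space) with the following local structure. For each $x\in X_{\mathcal{O}}$ and neighborhood $U$ of $x$ there are a neighborhood $U_x\subset U$ of $x$, an open set $\tilde U_x$ diffeomorphic to $\mathbb{R}^n$, a finite group $\Gamma_x$ acting smoothly and effectively on $\tilde U_x$ and fixing $0\in\tilde U_x$, and a homeomorphism $\phi_x:\tilde U_x/\Gamma_x\to U_x$ with $\phi_x(0)=x$. These satisfy: if $U_z\subset U_x$ is another such neighborhood with data $\tilde U_z,\Gamma_z,\phi_z$, there are a smooth embedding $\tilde\psi_{zx}:\tilde U_z\to\tilde U_x$ and an injective homomorphism $\theta_{zx}:\Gamma_z\to\Gamma_x$ such that $\tilde\psi_{zx}$ is $\theta_{zx}$-equivariant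 and covers the inclusion $U_z\subset U_x$. The pair $(\tilde U_x,\Gamma_x)$ is called an orbifold chart at $x$, and $\Gamma_x=\Gamma_{x,\mathcal{O}}$ the isotropy group of $x$ (well defined up to isomorphism). Write $\tilde x$ for the point $0\in\tilde U_x$ lying over $x$. Complete orbifold map. A smooth complete orbifold map $(f,\{\tilde f_x\},\{\Theta_{f,x}\}):\mathcal{O}\to\mathcal{P}$ consists of a continuous map $f:X_{\mathcal{O}}\to X_{\mathcal{P}}$ and, for each $x\in\mathcal{O}$, a group homomorphism $\Theta_{f,x}:\Gamma_x\to\Gamma_{f(x)}$ and a smooth $\Theta_{f,x}$-equivariant map $\tilde f_x:\tilde U_x\to\tilde V_{f(x)}$ covering $f|_{U_x}$, where $(\tilde U_x,\Gamma_x)$ and $(\tilde V_{f(x)},\Gamma_{f(x)})$ are orbifold charts at $x$ and $f(x)$. Two such maps are identified if for each $x$ the lifts agree as germs at $\tilde x$ and the homomorphisms agree. Regular value. A point $p\in\mathcal{P}$ is a regular value of $f$ if the differential $d\tilde f_x(\tilde x):T_{\tilde x}\tilde U_x\to T_{\tilde p}\tilde V_p$ is surjective for all $x\in f^{-1}(p)$. In particular, points $p\notin f(\mathcal{O})$ are regular values. The suborbifold $\mathcal{S}$. For a regular value $p$, $\mathcal{S}=f^{-1}(p)$ is a full smooth suborbifold of $\mathcal{O}$ of dimension $\dim\mathcal{O}-\dim\mathcal{P}$: near $x\in\mathcal{S}$ it is the quotient of the $\Gamma_{x,\mathcal{O}}$-invariant submanifold $\tilde S_x=\tilde f_x^{-1}(\tilde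 p)\subset\tilde U_x$, where $\tilde p=0\in\tilde V_p$, by $\Gamma_{x,\mathcal{O}}$ (full means that the whole isotropy group $\Gamma_{x,\mathcal{O}}$ is used). Its isotropy group is the quotient of $\Gamma_{x,\mathcal{O}}$ acting effectively, namely $\Gamma_{x,\mathcal{S}}=\Gamma_{x,\mathcal{O}}/G_{x,\mathcal{O}}$ with $G_{x,\mathcal{O}}=\{\gamma\in\Gamma_{x,\mathcal{O}}\mid d\gamma|_{\ker(d\tilde f_x(\tilde x))}=\mathrm{Id}\}$, where $d\gamma$ is the differential at $\tilde x$ of the action of $\gamma$. *)

theory Defs
  imports "HOL-Analysis.Analysis" "HOL-Algebra.Group_Action"
begin

text \<open>
  The type variables \<open>'e\<close>, \<open>'f\<close> play the role of \<open>\<real>\<^sup>n\<close>, \<open>\<real>\<^sup>m\<close>. They range over finite-dimensional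
  real inner product spaces instead of the class \<^class>\<open>euclidean_space\<close>, because the latter
  excludes dimension 0.
\<close>

definition model_dim :: "'e::real_vector itself \<Rightarrow> nat \<Rightarrow> bool" where
  "model_dim TYPE('e) n \<longleftrightarrow>
     (\<exists>B::'e set. finite B \<and> independent B \<and> span B = UNIV \<and> card B = n)"

definition paracompact_space :: "'a topology \<Rightarrow> bool" where
  "paracompact_space X \<longleftrightarrow>
     (\<forall>\<U>. (\<forall>U\<in>\<U>. openin X U) \<and> \<Union>\<U> = topspace X \<longrightarrow>
        (\<exists>\<V>. (\<forall>V\<in>\<V>. openin X V) \<and> \<Union>\<V> = topspace X \<and>
             (\<forall>V\<in>\<V>. \<exists>U\<in>\<U>. V \<subseteq> U) \<and> locally_finite_in X \<V>))"


section \<open>Smooth maps\<close>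

text \<open>
  On an open subset of a finite-dimensional space, \<open>f\<close> is of class \<open>C\<^sup>k\<close> iff all its iterated
  directional derivatives of order at most \<open>k\<close> exist as derivatives of differentiable maps and are
  continuous. Only used for open \<open>S\<close>, so values of \<open>f\<close> outside \<open>S\<close> are irrelevant.
\<close>

primrec Ck_on :: "nat \<Rightarrow> ('e::real_normed_vector \<Rightarrow> 'f::real_normed_vector) \<Rightarrow> 'e set \<Rightarrow> bool" where
  "Ck_on 0 f S \<longleftrightarrow> continuous_on S f"
| "Ck_on (Suc k) f S \<longleftrightarrow>
     (\<forall>x\<in>S. f differentiable (at x)) \<and> (\<forall>v. Ck_on k (\<lambda>x. frechet_derivative f (at x) v) S)"

definition smooth_on :: "('e::real_normed_vector \<Rightarrow> 'f::real_normed_vector) \<Rightarrow> 'e set \<Rightarrow> bool" where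
  "smooth_on f S \<longleftrightarrow> (\<forall>k. Ck_on k f S)"

definition diffeomorphic :: "'e::real_normed_vector set \<Rightarrow> 'f::real_normed_vector set \<Rightarrow> bool" where
  "diffeomorphic S T \<longleftrightarrow> (\<exists>h k. homeomorphism S T h k \<and> smooth_on h S \<and> smooth_on k T)"

definition smooth_embedding ::
    "('e::real_normed_vector \<Rightarrow> 'f::real_normed_vector) \<Rightarrow> 'e set \<Rightarrow> 'f set \<Rightarrow> bool" where
  "smooth_embedding \<psi> S T \<longleftrightarrow>
     \<psi> \<in> S \<rightarrow> T \<and> smooth_on \<psi> S \<and>
     (\<forall>y\<in>S. inj (frechet_derivative \<psi> (at y))) \<and> (\<exists>k. homeomorphism S (\<psi> ` S) \<psi> k)"


section \<open>Orbifolds\<close>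

definition orbit_topology ::
    "('g, 'z) monoid_scheme \<Rightarrow> 'e::topological_space set \<Rightarrow> ('g \<Rightarrow> 'e \<Rightarrow> 'e) \<Rightarrow> 'e set topology" where
  "orbit_topology G E \<alpha> =
     topology (\<lambda>W. W \<subseteq> orbits G E \<alpha> \<and> openin (top_of_set E) {y \<in> E. orbit G \<alpha> y \<in> W})"

lemma openin_orbit_topology:
  "openin (orbit_topology G E \<alpha>) W \<longleftrightarrow>
     W \<subseteq> orbits G E \<alpha> \<and> openin (top_of_set E) {y \<in> E. orbit G \<alpha> y \<in> W}"
proof -
  have "istopology (\<lambda>W. W \<subseteq> orbits G E \<alpha> \<and> openin (top_of_set E) {y \<in> E. orbit G \<alpha> y \<in> W})"
    (is "istopology ?P")
    unfolding istopology_def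
  proof (intro conjI allI impI)
    fix S T assume "?P S" "?P T"
    moreover have "{y \<in> E. orbit G \<alpha> y \<in> S \<inter> T} =
        {y \<in> E. orbit G \<alpha> y \<in> S} \<inter> {y \<in> E. orbit G \<alpha> y \<in> T}" by blast
    ultimately show "S \<inter> T \<subseteq> orbits G E \<alpha>"
      and "openin (top_of_set E) {y \<in> E. orbit G \<alpha> y \<in> S \<inter> T}" by auto
  next
    fix K assume K: "\<forall>S\<in>K. ?P S"
    then show "\<Union>K \<subseteq> orbits G E \<alpha>" by blast
    have "{y \<in> E. orbit G \<alpha> y \<in> \<Union>K} = (\<Union>S\<in>K. {y \<in> E. orbit G \<alpha> y \<in> S})" by blast
    then show "openin (top_of_set E) {y \<in> E. orbit G \<alpha> y \<in> \<Union>K}"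
      using K by (metis (no_types, lifting) imageE openin_Union)
  qed
  then show ?thesis
    by (simp add: orbit_topology_def)
qed

text \<open>
  A chart at the point \<open>centre\<close> consists of \<open>U~\<close> (\<open>cdom\<close>), \<open>\<Gamma>\<close> (\<open>cgroup\<close>), the action of \<open>\<Gamma>\<close> on
  \<open>U~\<close> (\<open>cact\<close>) and the homeomorphism \<open>\<phi>: U~/\<Gamma> \<rightarrow> U\<close> (\<open>cmap\<close>).
\<close>

record ('a, 'e, 'g) chart =
  centre :: 'a
  cdom :: "'e set"
  cgroup :: "'g monoid"
  cact :: "'g \<Rightarrow> 'e \<Rightarrow> 'e"
  cmap :: "'e set \<Rightarrow> 'a"

definition chart_nbhd :: "('a, 'e, 'g) chart \<Rightarrow> 'a set" where
  "chart_nbhd c = cmap c ` orbits (cgroup c) (cdom c) (cact c)"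

definition chart_proj :: "('a, 'e, 'g) chart \<Rightarrow> 'e \<Rightarrow> 'a" where
  "chart_proj c y = cmap c (orbit (cgroup c) (cact c) y)"

definition orbifold_chart :: "'a topology \<Rightarrow> ('a, 'e::real_inner, 'g) chart \<Rightarrow> bool" where
  "orbifold_chart X c \<longleftrightarrow>
     open (cdom c) \<and> 0 \<in> cdom c \<and> diffeomorphic (cdom c) (UNIV :: 'e set) \<and>
     finite (carrier (cgroup c)) \<and>
     faithful_action (cgroup c) (cdom c) (cact c) \<and>
     (\<forall>\<gamma>\<in>carrier (cgroup c). smooth_on (cact c \<gamma>) (cdom c) \<and> cact c \<gamma> 0 = 0) \<and>
     openin X (chart_nbhd c) \<and>
     homeomorphic_map (orbit_topology (cgroup c) (cdom c) (cact c))
       (subtopology X (chart_nbhd c)) (cmap c) \<and>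
     chart_proj c 0 = centre c"

definition chart_embedding ::
    "('a, 'e::real_inner, 'g) chart \<Rightarrow> ('a, 'e, 'g) chart \<Rightarrow> ('e \<Rightarrow> 'e) \<Rightarrow> ('g \<Rightarrow> 'g) \<Rightarrow> bool" where
  "chart_embedding c d \<psi> \<theta> \<longleftrightarrow>
     smooth_embedding \<psi> (cdom c) (cdom d) \<and>
     \<theta> \<in> mon (cgroup c) (cgroup d) \<and>
     (\<forall>\<gamma>\<in>carrier (cgroup c). \<forall>y\<in>cdom c. \<psi> (cact c \<gamma> y) = cact d (\<theta> \<gamma>) (\<psi> y)) \<and>
     (\<forall>y\<in>cdom c. chart_proj d (\<psi> y) = chart_proj c y)"

record ('a, 'e, 'g) orbifold =
  under :: "'a topology"
  charts :: "('a, 'e, 'g) chart set"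

text \<open>
  The group elements of all charts live in one type \<open>'g\<close>; this is no restriction, since every finite
  group is isomorphic to one on a subset of \<^typ>\<open>nat\<close>.
\<close>

definition smooth_orbifold :: "nat \<Rightarrow> ('a, 'e::real_inner, 'g) orbifold \<Rightarrow> bool" where
  "smooth_orbifold n \<O> \<longleftrightarrow>
     model_dim TYPE('e) n \<and>
     Hausdorff_space (under \<O>) \<and> paracompact_space (under \<O>) \<and>
     (\<forall>c\<in>charts \<O>. orbifold_chart (under \<O>) c) \<and>
     (\<forall>x\<in>topspace (under \<O>). \<forall>U. openin (under \<O>) U \<and> x \<in> U \<longrightarrow>
        (\<exists>c\<in>charts \<O>. centre c = x \<and> chart_nbhd c \<subseteq> U)) \<and>
     (\<forall>c\<in>charts \<O>. \<forall>d\<in>charts \<O>. chart_nbhd c \<subseteq> chart_nbhd d \<longrightarrow>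
        (\<exists>\<psi> \<theta>. chart_embedding c d \<psi> \<theta>))"


section \<open>Complete orbifold maps\<close>

text \<open>
  The charts \<open>(U~\<^sub>x, \<Gamma>\<^sub>x)\<close> at \<open>x\<close> and \<open>(V~\<^bsub>f(x)\<^esub>, \<Gamma>\<^bsub>f(x)\<^esub>)\<close> at \<open>f(x)\<close> used by the lift at \<open>x\<close> are part
  of the data; the chart at \<open>f(x)\<close> may depend on \<open>x\<close>. Such a record is a representative of a complete
  orbifold map: passing to a representative with the same germs of lifts and the same homomorphisms
  changes none of the notions below.
\<close>

record ('a, 'e, 'g, 'b, 'f, 'h) orbifold_map =
  pt_map :: "'a \<Rightarrow> 'b"
  src :: "'a \<Rightarrow> ('a, 'e, 'g) chart"
  tgt :: "'a \<Rightarrow> ('b, 'f, 'h) chart"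
  lift :: "'a \<Rightarrow> 'e \<Rightarrow> 'f"
  grp_map :: "'a \<Rightarrow> 'g \<Rightarrow> 'h"

definition smooth_complete_orbifold_map ::
    "('a, 'e::real_inner, 'g) orbifold \<Rightarrow> ('b, 'f::real_inner, 'h) orbifold \<Rightarrow>
     ('a, 'e, 'g, 'b, 'f, 'h) orbifold_map \<Rightarrow> bool" where
  "smooth_complete_orbifold_map \<O> \<P> F \<longleftrightarrow>
     continuous_map (under \<O>) (under \<P>) (pt_map F) \<and>
     (\<forall>x\<in>topspace (under \<O>).
        src F x \<in> charts \<O> \<and> centre (src F x) = x \<and>
        tgt F x \<in> charts \<P> \<and> centre (tgt F x) = pt_map F x \<and>
        grp_map F x \<in> hom (cgroup (src F x)) (cgroup (tgt F x)) \<and>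
        lift F x \<in> cdom (src F x) \<rightarrow> cdom (tgt F x) \<and>
        smooth_on (lift F x) (cdom (src F x)) \<and>
        (\<forall>\<gamma>\<in>carrier (cgroup (src F x)). \<forall>y\<in>cdom (src F x).
           lift F x (cact (src F x) \<gamma> y) = cact (tgt F x) (grp_map F x \<gamma>) (lift F x y)) \<and>
        (\<forall>y\<in>cdom (src F x).
           chart_proj (tgt F x) (lift F x y) = pt_map F (chart_proj (src F x) y)))"

definition fibre ::
    "('a, 'e, 'g) orbifold \<Rightarrow> ('a, 'e, 'g, 'b, 'f, 'h) orbifold_map \<Rightarrow> 'b \<Rightarrow> 'a set" where
  "fibre \<O> F p = {x \<in> topspace (under \<O>). pt_map F x = p}"

definition regular_value ::
    "('a, 'e::real_inner, 'g) orbifold \<Rightarrow> ('b, 'f::real_inner, 'h) orbifold \<Rightarrow>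
     ('a, 'e, 'g, 'b, 'f, 'h) orbifold_map \<Rightarrow> 'b \<Rightarrow> bool" where
  "regular_value \<O> \<P> F p \<longleftrightarrow>
     p \<in> topspace (under \<P>) \<and>
     (\<forall>x\<in>fibre \<O> F p. surj (frechet_derivative (lift F x) (at 0)))"


section \<open>Isotropy groups\<close>

definition isotropy ::
    "('a, 'e, 'g, 'b, 'f, 'h) orbifold_map \<Rightarrow> 'a \<Rightarrow> 'g monoid" where
  "isotropy F x = cgroup (src F x)"

definition map_kernel ::
    "('a, 'e, 'g, 'b, 'f, 'h) orbifold_map \<Rightarrow> 'a \<Rightarrow> 'g monoid" where
  "map_kernel F x =
     (isotropy F x)\<lparr>carrier := kernel (isotropy F x) (cgroup (tgt F x)) (grp_map F x)\<rparr>"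

text \<open>
  At a regular value, the full suborbifold \<open>\<S> = f\<^sup>-\<^sup>1(p)\<close> is near \<open>x\<close> the quotient by \<open>\<Gamma>\<^sub>x\<close> of the
  submanifold \<open>{y \<in> U~\<^sub>x. f~\<^sub>x(y) = 0}\<close>, whose tangent space at \<open>0\<close> is \<open>ker (df~\<^sub>x(0))\<close>. So
  \<open>fixing_subgroup F x\<close> is the ineffective part \<open>G\<^sub>x\<close> of that action, and the isotropy group of \<open>\<S>\<close>
  at \<open>x\<close> is the effectively acting quotient \<open>\<Gamma>\<^sub>x/G\<^sub>x\<close>.
\<close>

definition fixing_subgroup ::
    "('a, 'e::real_inner, 'g, 'b, 'f::real_inner, 'h) orbifold_map \<Rightarrow> 'a \<Rightarrow> 'g set" where
  "fixing_subgroup F x =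
     {\<gamma> \<in> carrier (isotropy F x).
        \<forall>v. frechet_derivative (lift F x) (at 0) v = 0 \<longrightarrow>
            frechet_derivative (cact (src F x) \<gamma>) (at 0) v = v}"

definition fibre_isotropy ::
    "('a, 'e::real_inner, 'g, 'b, 'f::real_inner, 'h) orbifold_map \<Rightarrow> 'a \<Rightarrow> 'g set monoid" where
  "fibre_isotropy F x = isotropy F x Mod fixing_subgroup F x"

end

theory Submission
  imports Defs "HOL-Algebra.Multiplicative_Group"
begin

text \<open>
  The representation is the restriction to \<open>N\<^sub>x\<close> of the projection \<open>\<Gamma>\<^sub>x \<rightarrow> \<Gamma>\<^sub>x/G\<^sub>x\<close>; it is injective
  iff \<open>N\<^sub>x \<inter> G\<^sub>x\<close> is trivial. Let \<open>\<gamma>\<close> lie in both, and let \<open>D\<close> and \<open>L\<close> be the differentials at \<open>0\<close> of the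
  lift and of \<open>\<gamma>\<close>. The lift is \<open>\<gamma>\<close>-invariant, so \<open>D L = D\<close>, and \<open>L\<close> is the identity on \<open>ker D\<close>. Hence
  \<open>A = L - I\<close> has its image in \<open>ker D\<close> and vanishes there, so \<open>A\<^sup>2 = 0\<close> and \<open>L\<^sup>N = I + N A\<close>. As \<open>\<gamma>\<close> has
  finite order, \<open>A = 0\<close>. Finally, an element of a finite group acting smoothly and effectively on a
  connected open set which fixes a point to first order is trivial.
\<close>

section \<open>Calculus in finite-dimensional inner product spaces\<close>

lemma smooth_on_has_derivative:
  assumes "smooth_on f S" "x \<in> S"
  shows "(f has_derivative frechet_derivative f (at x)) (at x)"
proof -
  have "Ck_on (Suc 0) f S" using assms(1) unfolding smooth_on_def by blast
  then show ?thesis using assms(2) by (simp add: frechet_derivative_works)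
qed

lemma smooth_on_continuous_derivative:
  assumes "smooth_on f S"
  shows "continuous_on S (\<lambda>x. frechet_derivative f (at x) v)"
proof -
  have "Ck_on (Suc 0) f S" using assms unfolding smooth_on_def by blast
  then show ?thesis by simp
qed

lemma smooth_on_imp_continuous_on: "smooth_on f S \<Longrightarrow> continuous_on S f"
  unfolding smooth_on_def by (drule spec[of _ 0]) simp

text \<open>Expand \<open>v\<close> in an orthogonal spanning set and apply Cauchy-Schwarz to each
  coefficient. Since \<open>C\<close> is chosen before \<open>L\<close>, the bound is uniform in
  \<open>L\<close>: smallness of \<open>L\<close> on finitely many vectors makes it small in
  operator norm.\<close>

lemma finite_dim_norm_bound:
  fixes B :: "'e::real_inner set"
  assumes "finite B" "span B = UNIV"
  obtains C :: "'e set" where "finite C"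
    and "\<And>(L::'e \<Rightarrow> 'f::real_normed_vector) v. linear L \<Longrightarrow>
           norm (L v) \<le> (\<Sum>c\<in>C. norm (L c) / norm c) * norm v"
proof -
  obtain C where C: "finite C" "span C = span B" "pairwise orthogonal C"
    using basis_orthogonal[OF assms(1)] by blast
  \<comment> \<open>\<open>C\<close> may contain 0. As division by zero yields 0, such a term
    vanishes both here and in the final bound.\<close>
  have expand: "v = (\<Sum>c\<in>C. ((v \<bullet> c) / (c \<bullet> c)) *\<^sub>R c)" for v
  proof -
    define w where "w = v - (\<Sum>c\<in>C. ((v \<bullet> c) / (c \<bullet> c)) *\<^sub>R c)"
    have "orthogonal w d" if "d \<in> C" for d
    proof -
      have "(\<Sum>c\<in>C. ((v \<bullet> c) / (c \<bullet> c)) * (c \<bullet> d)) = (\<Sum>c\<in>C. if c = d then v \<bullet> d else 0)"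
        using C(3) that by (intro sum.cong) (auto simp: pairwise_def orthogonal_def)
      then show ?thesis
        using C(1) that by (simp add: w_def orthogonal_def inner_diff_left inner_sum_left)
    qed
    then have "orthogonal w w"
      by (intro orthogonal_to_span[of w C]) (auto simp: C(2) assms(2))
    then show ?thesis by (simp add: w_def orthogonal_self)
  qed
  show thesis
  proof
    show "finite C" by fact
    fix L :: "'e \<Rightarrow> 'f" and v assume L: "linear L"
    have "norm (L v) = norm (\<Sum>c\<in>C. ((v \<bullet> c) / (c \<bullet> c)) *\<^sub>R L c)"
      by (subst (1) expand) (simp add: linear_sum[OF L] linear_cmul[OF L])
    also have "\<dots> \<le> (\<Sum>c\<in>C. norm (L c) / norm c * norm v)"
    proof (rule sum_norm_le)
      fix c
      have "\<bar>v \<bullet> c\<bar> / (c \<bullet> c) \<le> norm v * norm c / (c \<bullet> c)"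
        by (intro divide_right_mono Cauchy_Schwarz_ineq2) simp
      also have "\<dots> = norm v / norm c"
        by (simp add: dot_square_norm power2_eq_square)
      finally have "\<bar>v \<bullet> c\<bar> / (c \<bullet> c) * norm (L c) \<le> norm v / norm c * norm (L c)"
        by (rule mult_right_mono) simp
      then show "norm (((v \<bullet> c) / (c \<bullet> c)) *\<^sub>R L c) \<le> norm (L c) / norm c * norm v"
        by (simp add: mult.commute)
    qed
    finally show "norm (L v) \<le> (\<Sum>c\<in>C. norm (L c) / norm c) * norm v"
      by (simp add: sum_distrib_right)
  qed
qed

text \<open>Near \<open>a\<close> the map \<open>f - k id\<close> has derivative of norm at most
  \<open>k / 2\<close>, so it is \<open>k / 2\<close>-Lipschitz on a ball. If
  \<open>f y = f z\<close>, its increment is \<open>k (z - y)\<close>, which is too long unless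
  \<open>y = z\<close>.\<close>

lemma locally_inj_scalar_derivative:
  fixes f :: "'e::real_inner \<Rightarrow> 'e" and B :: "'e set" and k :: real
  assumes B: "finite B" "span B = UNIV"
    and S: "open S" "a \<in> S"
    and der: "\<And>x. x \<in> S \<Longrightarrow> (f has_derivative f' x) (at x)"
    and cont: "\<And>v. continuous_on S (\<lambda>x. f' x v)"
    and k: "k > 0" "\<And>v. f' a v = k *\<^sub>R v"
  obtains e where "e > 0" "inj_on f (ball a e)"
proof -
  obtain C :: "'e set" where C: "finite C" and bound:
    "\<And>(L::'e \<Rightarrow> 'e) v. linear L \<Longrightarrow> norm (L v) \<le> (\<Sum>c\<in>C. norm (L c) / norm c) * norm v"
    using finite_dim_norm_bound[OF B] by blast
  \<comment> \<open>A continuous bound on the operator norm of \<open>f' x - k id\<close>, zero at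
    \<open>a\<close>; it turns the directionwise continuity \<open>cont\<close> into operator-norm
    smallness.\<close>
  define s where "s x = (\<Sum>c\<in>C. norm (f' x c - k *\<^sub>R c) / norm c)" for x
  have "continuous_on S s" unfolding s_def divide_inverse by (intro continuous_intros cont)
  then have "isCont s a" using S continuous_on_eq_continuous_at by blast
  moreover have "s a = 0" by (simp add: s_def k)
  ultimately have "\<forall>\<^sub>F x in at a. s x < k / 2"
    using k(1) order_tendstoD(2)[of s "s a" "at a" "k / 2"] by (simp add: isCont_def)
  then obtain U where U: "open U" "a \<in> U" "\<And>x. x \<in> U \<Longrightarrow> s x < k / 2"
    using \<open>s a = 0\<close> k(1) unfolding eventually_at_topological by force
  have "open (U \<inter> S)" "a \<in> U \<inter> S" using U S by auto
  then obtain e where e: "e > 0" "ball a e \<subseteq> U \<inter> S"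
    by (meson open_contains_ball)
  have "inj_on f (ball a e)"
  proof (rule inj_onI)
    fix y z assume yz: "y \<in> ball a e" "z \<in> ball a e" "f y = f z"
    have le: "norm ((f y - k *\<^sub>R y) - (f z - k *\<^sub>R z)) \<le> k / 2 * norm (y - z)"
    proof (rule differentiable_bound[OF convex_ball _ _ yz(1,2)])
      fix x assume x: "x \<in> ball a e"
      then have "(f has_derivative f' x) (at x)" using der e by blast
      then show der': "((\<lambda>y. f y - k *\<^sub>R y) has_derivative (\<lambda>v. f' x v - k *\<^sub>R v))
          (at x within ball a e)"
        by (intro has_derivative_diff has_derivative_scaleR_right has_derivative_ident)
          (rule has_derivative_at_withinI)
      have "norm (f' x v - k *\<^sub>R v) \<le> s x * norm v" for v :: 'e
        unfolding s_def using has_derivative_linear[OF der'] by (rule bound)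
      also have "s x * norm v \<le> k / 2 * norm v" for v :: 'e
        using U(3)[of x] x e by (intro mult_right_mono) auto
      finally show "onorm (\<lambda>v. f' x v - k *\<^sub>R v) \<le> k / 2"
        using k(1) by (intro onorm_bound) auto
    qed
    have "(f y - k *\<^sub>R y) - (f z - k *\<^sub>R z) = k *\<^sub>R (z - y)"
      using yz(3) by (simp add: scaleR_right_diff_distrib)
    then have "k * norm (y - z) \<le> 0"
      using le k(1) by (simp add: norm_minus_commute[of z y])
    then show "y = z" using k(1) by (simp add: mult_le_0_iff)
  qed
  with e(1) that show thesis by blast
qed


section \<open>Finite smooth actions\<close>

text \<open>Isolates the group action carried by a chart; it is instantiated both at
  \<open>x\<close> and at its image.\<close>

locale finite_smooth_action = faithful_action G E \<alpha>
  for G (structure) and E :: "'e::real_inner set" and \<alpha> :: "'g \<Rightarrow> 'e \<Rightarrow> 'e" +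
  assumes finite_group: "finite (carrier G)"
    and open_domain: "open E"
    and smooth: "\<gamma> \<in> carrier G \<Longrightarrow> smooth_on (\<alpha> \<gamma>) E"
begin

sublocale group G
  using group_hom by (rule group_hom.axioms(1))

abbreviation D :: "'g \<Rightarrow> 'e \<Rightarrow> 'e \<Rightarrow> 'e" where
  "D \<gamma> y \<equiv> frechet_derivative (\<alpha> \<gamma>) (at y)"

lemma der: "\<gamma> \<in> carrier G \<Longrightarrow> y \<in> E \<Longrightarrow> (\<alpha> \<gamma> has_derivative D \<gamma> y) (at y)"
  using smooth by (rule smooth_on_has_derivative)

lemma D_eqI:
  assumes "\<gamma> \<in> carrier G" "open U" "y \<in> U" "U \<subseteq> E"
    and "\<And>z. z \<in> U \<Longrightarrow> \<alpha> \<gamma> z = h z" and "(h has_derivative h') (at y)"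
  shows "D \<gamma> y = h'"
proof -
  have "(\<alpha> \<gamma> has_derivative h') (at y)"
    using has_derivative_transform_within_open[OF assms(6,2,3)] assms(5) by simp
  then show ?thesis by (rule frechet_derivative_at[symmetric])
qed

lemma act_one: "y \<in> E \<Longrightarrow> \<alpha> \<one> y = y"
  by (metis id_eq_one restrict_apply')

lemma D_mult:
  assumes "\<gamma> \<in> carrier G" "\<delta> \<in> carrier G" "y \<in> E"
  shows "D (\<gamma> \<otimes> \<delta>) y = (\<lambda>v. D \<gamma> (\<alpha> \<delta> y) (D \<delta> y v))"
proof (rule D_eqI[OF _ open_domain assms(3) order_refl])
  have "\<alpha> \<delta> y \<in> E" using assms(2,3) element_image by blast
  then show "((\<lambda>z. \<alpha> \<gamma> (\<alpha> \<delta> z)) has_derivative (\<lambda>v. D \<gamma> (\<alpha> \<delta> y) (D \<delta> y v))) (at y)"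
    using has_derivative_compose[OF der[OF assms(2,3)] der[OF assms(1)]] by blast
  show "\<gamma> \<otimes> \<delta> \<in> carrier G" using assms by simp
  show "\<alpha> (\<gamma> \<otimes> \<delta>) z = \<alpha> \<gamma> (\<alpha> \<delta> z)" if "z \<in> E" for z
    using assms that by (simp add: composition_rule)
qed

lemma D_one: "y \<in> E \<Longrightarrow> D \<one> y = (\<lambda>v. v)"
  by (rule D_eqI[OF _ open_domain]) (auto simp: act_one)

lemma pow_fixed:
  assumes "\<gamma> \<in> carrier G" "a \<in> E" "\<alpha> \<gamma> a = a"
  shows "\<alpha> (\<gamma> [^] (j::nat)) a = a" "D (\<gamma> [^] j) a = (D \<gamma> a) ^^ j"
proof (induction j)
  case 0
  show "\<alpha> (\<gamma> [^] (0::nat)) a = a" "D (\<gamma> [^] (0::nat)) a = (D \<gamma> a) ^^ 0"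
    using assms by (auto simp: act_one D_one)
next
  case (Suc j)
  show "\<alpha> (\<gamma> [^] Suc j) a = a"
    using Suc assms by (simp add: composition_rule)
  show "D (\<gamma> [^] Suc j) a = (D \<gamma> a) ^^ Suc j"
    using Suc assms by (simp add: D_mult funpow_Suc_right comp_def del: funpow.simps)
qed

text \<open>
  The orbit sum \<open>T = (\<Sum>j<N. \<gamma>\<^sup>j)\<close> satisfies \<open>T \<circ> \<gamma> = T\<close> and is injective near \<open>a\<close>, as its
  differential there is \<open>N\<close> times the identity.
\<close>

lemma locally_fixed:
  assumes B: "finite B" "span B = (UNIV :: 'e set)"
    and \<gamma>: "\<gamma> \<in> carrier G" and a: "a \<in> E" "\<alpha> \<gamma> a = a" "D \<gamma> a = (\<lambda>v. v)"
  obtains U where "open U" "a \<in> U" "U \<subseteq> E" "\<And>y. y \<in> U \<Longrightarrow> \<alpha> \<gamma> y = y"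
proof -
  \<comment> \<open>The group order serves as a common exponent: \<open>\<gamma>\<close> to the
    power \<open>N\<close> is \<open>\<one>\<close>.\<close>
  define N where "N = order G"
  have N: "N > 0" using finite_group by (simp add: N_def order_gt_0_iff_finite)
  define T where "T y = (\<Sum>j<N. \<alpha> (\<gamma> [^] j) y)" for y
  define T' where "T' y v = (\<Sum>j<N. D (\<gamma> [^] j) y v)" for y v
  have id_pow: "((\<lambda>v::'e. v) ^^ j) w = w" for j w by (induction j) auto
  have T'_a: "T' a v = real N *\<^sub>R v" for v
    using pow_fixed(2)[OF \<gamma> a(1,2)] by (simp add: T'_def a(3) id_pow sum_constant_scaleR)
  have T_der: "(T has_derivative T' y) (at y)" if "y \<in> E" for y
    unfolding T_def T'_def using that \<gamma> by (intro has_derivative_sum der) auto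
  have T_cont: "continuous_on E (\<lambda>y. T' y v)" for v
    unfolding T'_def using \<gamma> smooth
    by (intro continuous_on_sum smooth_on_continuous_derivative) auto
  obtain e where e: "e > 0" "inj_on T (ball a e)"
    by (rule locally_inj_scalar_derivative[OF B open_domain a(1) T_der T_cont _ T'_a])
      (use N in auto)
  have T_inv: "T (\<alpha> \<gamma> y) = T y" if "y \<in> E" for y
  proof -
    have "\<alpha> (\<gamma> [^] j) (\<alpha> \<gamma> y) = \<alpha> (\<gamma> [^] Suc j) y" for j
      using \<gamma> that by (simp add: composition_rule)
    then have "T (\<alpha> \<gamma> y) = (\<Sum>j<N. \<alpha> (\<gamma> [^] Suc j) y)"
      unfolding T_def by (simp only:)
    \<comment> \<open>Precomposing with \<open>\<gamma>\<close> shifts the sum by one: the term for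
      0 is dropped, the term for \<open>N\<close> is gained, and the two agree.\<close>
    moreover have "\<alpha> (\<gamma> [^] N) y = \<alpha> (\<gamma> [^] (0::nat)) y"
      using pow_order_eq_1[OF \<gamma>] by (simp add: N_def)
    ultimately show ?thesis
      using sum.lessThan_Suc_shift[of "\<lambda>j. \<alpha> (\<gamma> [^] j) y" N] by (simp add: T_def del: nat_pow_Suc)
  qed
  have "continuous_on E (\<alpha> \<gamma>)"
    using smooth[OF \<gamma>] by (rule smooth_on_imp_continuous_on)
  then have "open (E \<inter> \<alpha> \<gamma> -` ball a e)"
    using open_domain by (simp add: continuous_on_open_vimage Int_commute)
  \<comment> \<open>Both \<open>y\<close> and \<open>\<alpha> \<gamma> y\<close> must lie in the
    ball before injectivity of \<open>T\<close> can identify them.\<close>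
  then have "open (ball a e \<inter> (E \<inter> \<alpha> \<gamma> -` ball a e))" by blast
  then show thesis
  proof (rule that)
    fix y assume "y \<in> ball a e \<inter> (E \<inter> \<alpha> \<gamma> -` ball a e)"
    then show "\<alpha> \<gamma> y = y" using inj_onD[OF e(2), of "\<alpha> \<gamma> y" y] T_inv[of y] by simp
  qed (use a e in auto)
qed

text \<open>The points fixed to first order form a clopen set \<open>Z\<close>. It is closed by
  continuity and open by \<open>locally_fixed\<close>, since a map that is the identity near a point
  has identity differential there. The condition on the differential is what makes \<open>Z\<close>
  open: a reflection shows that a plain fixed-point set need not be.\<close>

lemma fixed_to_first_order_imp_one:
  assumes B: "finite B" "span B = (UNIV :: 'e set)" and conn: "connected E"
    and \<gamma>: "\<gamma> \<in> carrier G" and a: "a \<in> E" "\<alpha> \<gamma> a = a" "D \<gamma> a = (\<lambda>v. v)"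
  shows "\<gamma> = \<one>"
proof -
  define Z where "Z = {y \<in> E. \<alpha> \<gamma> y = y \<and> D \<gamma> y = (\<lambda>v. v)}"
  have "\<exists>U. open U \<and> y \<in> U \<and> U \<subseteq> Z" if "y \<in> Z" for y
  proof -
    have y: "y \<in> E" "\<alpha> \<gamma> y = y" "D \<gamma> y = (\<lambda>v. v)"
      using that unfolding Z_def by auto
    obtain U where U: "open U" "y \<in> U" "U \<subseteq> E" "\<And>z. z \<in> U \<Longrightarrow> \<alpha> \<gamma> z = z"
      using locally_fixed[OF B \<gamma> y] by metis
    have "D \<gamma> z = (\<lambda>v. v)" if "z \<in> U" for z
      by (rule D_eqI[OF \<gamma> U(1) that U(3) U(4) has_derivative_ident])
    then show ?thesis using U unfolding Z_def by blast
  qed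
  then have "open Z" using open_subopen by blast
  moreover have "Z \<subseteq> E" unfolding Z_def by blast
  ultimately have "openin (top_of_set E) Z" using open_domain by (simp add: openin_open_eq)
  moreover have "closedin (top_of_set E) Z"
  proof -
    have "continuous_on E (\<lambda>y. \<alpha> \<gamma> y - y)"
      using smooth[OF \<gamma>] by (intro continuous_on_diff continuous_on_id smooth_on_imp_continuous_on)
    then have 1: "closedin (top_of_set E) {y \<in> E. \<alpha> \<gamma> y - y = 0}"
      by (rule continuous_closedin_preimage_constant)
    have 2: "closedin (top_of_set E) {y \<in> E. D \<gamma> y v = v}" for v
      using smooth[OF \<gamma>]
      by (intro continuous_closedin_preimage_constant smooth_on_continuous_derivative)
    have "Z = {y \<in> E. \<alpha> \<gamma> y - y = 0} \<inter> (\<Inter>v. {y \<in> E. D \<gamma> y v = v})"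
      unfolding Z_def by (auto simp: fun_eq_iff)
    also have "closedin (top_of_set E) \<dots>"
      using 1 2 by (intro closedin_Int closedin_INT) auto
    finally show ?thesis .
  qed
  moreover have "Z \<noteq> {}" using a unfolding Z_def by blast
  ultimately have "Z = E" using conn unfolding connected_clopen by blast
  \<comment> \<open>Faithfulness compares elements of \<open>Bij E\<close>, which are extensional,
    so equality is also checked outside \<open>E\<close>, where both sides are
    \<open>undefined\<close>.\<close>
  then have "\<alpha> \<gamma> y = \<alpha> \<one> y" for y
    using bij_prop0[OF \<gamma>] bij_prop0[OF one_closed] unfolding Z_def
    by (cases "y \<in> E") (auto simp: act_one Bij_def extensional_def)
  then show ?thesis using faithful \<gamma> by (auto dest: inj_onD)
qed

end

text \<open>\<open>fix2\<close> says that \<open>L - I\<close> squares to zero, so the iterates of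
  \<open>L\<close> move \<open>v\<close> linearly in the exponent. Returning to \<open>v\<close>
  after \<open>N > 0\<close> steps forces zero displacement.\<close>

lemma unipotent_finite_order_imp_id:
  fixes L :: "'v::real_vector \<Rightarrow> 'v"
  assumes "linear L" and fix2: "\<And>v. L (L v - v) = L v - v"
    and N: "N > 0" "L ^^ N = (\<lambda>v. v)"
  shows "L = (\<lambda>v. v)"
proof
  fix v
  have "(L ^^ j) v = v + real j *\<^sub>R (L v - v)" for j
  proof (induction j)
    case (Suc j)
    have "(L ^^ Suc j) v = L v + real j *\<^sub>R L (L v - v)"
      using Suc by (simp add: linear_add[OF \<open>linear L\<close>] linear_cmul[OF \<open>linear L\<close>])
    then show ?case by (simp add: fix2 algebra_simps)
  qed simp
  from this[of N] show "L v = v" using N by simp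
qed


section \<open>Injectivity on the kernel\<close>

lemma orbifold_chart_finite_smooth_action:
  assumes "orbifold_chart X c"
  shows "finite_smooth_action (cgroup c) (cdom c) (cact c)"
  using assms unfolding orbifold_chart_def finite_smooth_action_def finite_smooth_action_axioms_def
  by blast

lemma orbifold_chart_connected:
  fixes c :: "('a, 'e::real_inner, 'g) chart"
  assumes "orbifold_chart X c"
  shows "connected (cdom c)"
proof -
  have "cdom c homeomorphic (UNIV :: 'e set)"
    using assms unfolding orbifold_chart_def diffeomorphic_def homeomorphic_def by blast
  then show ?thesis using homeomorphic_connectedness by blast
qed

text \<open>\<open>cmap\<close> is injective on orbits, so the points over the centre form the orbit
  of 0, which is a single point because the group fixes 0. This makes lifts send 0 to 0.\<close>

lemma chart_proj_centre_unique:
  assumes c: "orbifold_chart X c" and y: "y \<in> cdom c" "chart_proj c y = centre c"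
  shows "y = 0"
proof -
  interpret finite_smooth_action "cgroup c" "cdom c" "cact c"
    using c by (rule orbifold_chart_finite_smooth_action)
  let ?o = "orbit (cgroup c) (cact c)"
  have top: "topspace (orbit_topology (cgroup c) (cdom c) (cact c)) =
      orbits (cgroup c) (cdom c) (cact c)"
  proof -
    have "{z \<in> cdom c. ?o z \<in> orbits (cgroup c) (cdom c) (cact c)} = cdom c"
      unfolding orbits_def by blast
    then have "openin (orbit_topology (cgroup c) (cdom c) (cact c))
        (orbits (cgroup c) (cdom c) (cact c))"
      by (simp add: openin_orbit_topology)
    then show ?thesis
      unfolding topspace_def by (auto simp: openin_orbit_topology)
  qed
  have "inj_on (cmap c) (orbits (cgroup c) (cdom c) (cact c))"
    using c homeomorphic_imp_injective_map top unfolding orbifold_chart_def by metis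
  moreover have "cmap c (?o y) = cmap c (?o 0)"
    using c y unfolding orbifold_chart_def chart_proj_def by simp
  moreover have "0 \<in> cdom c" using c unfolding orbifold_chart_def by blast
  ultimately have "?o y = ?o 0"
    using y(1) unfolding orbits_def by (auto dest: inj_onD)
  then have "y \<in> ?o 0" using orbit_refl[OF y(1)] by simp
  then show ?thesis using c unfolding orbit_def orbifold_chart_def by auto
qed

theorem proposition18:
  fixes \<O> :: "('a, 'e::real_inner, 'g) orbifold"
    and \<P> :: "('b, 'f::real_inner, 'h) orbifold"
    and F :: "('a, 'e, 'g, 'b, 'f, 'h) orbifold_map"
    and n m :: nat and p :: 'b and x :: 'a
  assumes "smooth_orbifold n \<O>" and "smooth_orbifold m \<P>" and "n \<ge> m"
    and "smooth_complete_orbifold_map \<O> \<P> F"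
    and "regular_value \<O> \<P> F p"
    and "x \<in> fibre \<O> F p"
  shows "\<exists>\<rho>. group_hom (map_kernel F x) (fibre_isotropy F x) \<rho> \<and>
             inj_on \<rho> (carrier (map_kernel F x))"
proof -
  define c where "c = src F x"
  define d where "d = tgt F x"
  define f where "f = lift F x"
  define \<Theta> where "\<Theta> = grp_map F x"
  have x: "x \<in> topspace (under \<O>)" using assms(6) by (simp add: fibre_def)
  have cd: "c \<in> charts \<O>" "centre c = x" "d \<in> charts \<P>" "centre d = pt_map F x"
    and \<Theta>: "\<Theta> \<in> hom (cgroup c) (cgroup d)"
    and f: "f \<in> cdom c \<rightarrow> cdom d" "smooth_on f (cdom c)"
    and equi: "\<And>\<gamma> y. \<gamma> \<in> carrier (cgroup c) \<Longrightarrow> y \<in> cdom c \<Longrightarrow>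
        f (cact c \<gamma> y) = cact d (\<Theta> \<gamma>) (f y)"
    and cover: "\<And>y. y \<in> cdom c \<Longrightarrow> chart_proj d (f y) = pt_map F (chart_proj c y)"
    using assms(4) x unfolding smooth_complete_orbifold_map_def c_def d_def f_def \<Theta>_def by auto
  have oc: "orbifold_chart (under \<O>) c"
    using assms(1) cd(1) by (simp add: smooth_orbifold_def)
  have od: "orbifold_chart (under \<P>) d"
    using assms(2) cd(3) by (simp add: smooth_orbifold_def)
  have "model_dim TYPE('e) n"
    using assms(1) by (simp add: smooth_orbifold_def)
  then obtain B :: "'e set" where B: "finite B" "span B = UNIV"
    unfolding model_dim_def by blast
  interpret C: finite_smooth_action "cgroup c" "cdom c" "cact c"
    using oc by (rule orbifold_chart_finite_smooth_action)
  interpret D: finite_smooth_action "cgroup d" "cdom d" "cact d"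
    using od by (rule orbifold_chart_finite_smooth_action)
  interpret \<Theta>: group_hom "cgroup c" "cgroup d" \<Theta>
    using \<Theta> by unfold_locales
  have zero: "0 \<in> cdom c" "\<And>\<gamma>. \<gamma> \<in> carrier (cgroup c) \<Longrightarrow> cact c \<gamma> 0 = 0"
    using oc unfolding orbifold_chart_def by auto
  have f0: "f 0 = 0"
  proof (rule chart_proj_centre_unique[OF od])
    show "f 0 \<in> cdom d" using f(1) zero(1) by blast
    show "chart_proj d (f 0) = centre d"
      using cover[OF zero(1)] oc cd by (simp add: orbifold_chart_def)
  qed
  define f' where "f' = frechet_derivative f (at 0)"
  have f': "(f has_derivative f') (at 0)"
    unfolding f'_def using f(2) zero(1) by (rule smooth_on_has_derivative)
  interpret f': linear f' using f' by (rule has_derivative_linear)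

  \<comment> \<open>Differentiate both sides of the equivariance of the lift at 0 and use uniqueness
    of the derivative.\<close>
  have f'_equi: "f' (C.D \<gamma> 0 v) = D.D (\<Theta> \<gamma>) 0 (f' v)" if \<gamma>: "\<gamma> \<in> carrier (cgroup c)" for \<gamma> v
  proof -
    have "((\<lambda>y. f (cact c \<gamma> y)) has_derivative (\<lambda>v. f' (C.D \<gamma> 0 v))) (at 0)"
      using C.der[OF \<gamma> zero(1)] f' zero(2)[OF \<gamma>] by (auto intro: has_derivative_compose)
    then have 1: "((\<lambda>y. cact d (\<Theta> \<gamma>) (f y)) has_derivative (\<lambda>v. f' (C.D \<gamma> 0 v))) (at 0)"
      by (rule has_derivative_transform_within_open[OF _ C.open_domain zero(1)])
        (simp add: equi \<gamma>)
    have "(cact d (\<Theta> \<gamma>) has_derivative D.D (\<Theta> \<gamma>) 0) (at (f 0))"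
      using D.der[of "\<Theta> \<gamma>" 0] \<gamma> od by (simp add: f0 orbifold_chart_def)
    then have "((\<lambda>y. cact d (\<Theta> \<gamma>) (f y)) has_derivative (\<lambda>v. D.D (\<Theta> \<gamma>) 0 (f' v))) (at 0)"
      using f' by (auto intro: has_derivative_compose)
    from fun_cong[OF has_derivative_unique[OF 1 this]] show ?thesis .
  qed
  have C_mult: "C.D (\<gamma> \<otimes>\<^bsub>cgroup c\<^esub> \<delta>) 0 v = C.D \<gamma> 0 (C.D \<delta> 0 v)"
    if "\<gamma> \<in> carrier (cgroup c)" "\<delta> \<in> carrier (cgroup c)" for \<gamma> \<delta> v
    using C.D_mult[OF that zero(1)] zero(2) that by simp
  have C_lin: "linear (C.D \<gamma> 0)" if "\<gamma> \<in> carrier (cgroup c)" for \<gamma>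
    using C.der[OF that zero(1)] by (rule has_derivative_linear)
  \<comment> \<open>The kernel of \<open>f'\<close>, the tangent space of the fibre, is invariant
    under the isotropy group; normality of \<open>H\<close> rests on this.\<close>
  have ker: "f' (C.D \<gamma> 0 v) = 0" if "\<gamma> \<in> carrier (cgroup c)" "f' v = 0" for \<gamma> v
  proof -
    have "linear (D.D (\<Theta> \<gamma>) 0)"
      using D.der[of "\<Theta> \<gamma>" 0] that od
      by (auto simp: orbifold_chart_def intro: has_derivative_linear)
    then show ?thesis using f'_equi[OF that(1)] that(2) by (simp add: linear_0)
  qed

  define H where "H = {\<gamma> \<in> carrier (cgroup c). \<forall>v. f' v = 0 \<longrightarrow> C.D \<gamma> 0 v = v}"
  have H: "fixing_subgroup F x = H"
    by (simp add: fixing_subgroup_def isotropy_def H_def c_def f'_def f_def)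
  have inv_D: "C.D (inv\<^bsub>cgroup c\<^esub> \<gamma>) 0 (C.D \<gamma> 0 v) = v" "C.D \<gamma> 0 (C.D (inv\<^bsub>cgroup c\<^esub> \<gamma>) 0 v) = v"
    if "\<gamma> \<in> carrier (cgroup c)" for \<gamma> v
    using C_mult[of "inv\<^bsub>cgroup c\<^esub> \<gamma>" \<gamma> v] C_mult[of \<gamma> "inv\<^bsub>cgroup c\<^esub> \<gamma>" v] that C.D_one[OF zero(1)]
    by auto
  have "subgroup H (cgroup c)"
  proof
    fix \<gamma> assume "\<gamma> \<in> H"
    then have \<gamma>: "\<gamma> \<in> carrier (cgroup c)" "\<And>v. f' v = 0 \<Longrightarrow> C.D \<gamma> 0 v = v"
      by (simp_all add: H_def)
    have "C.D (inv\<^bsub>cgroup c\<^esub> \<gamma>) 0 v = v" if "f' v = 0" for v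
      using inv_D(1)[OF \<gamma>(1), of v] \<gamma>(2)[OF that] by simp
    then show "inv\<^bsub>cgroup c\<^esub> \<gamma> \<in> H" using \<gamma>(1) by (simp add: H_def)
  next
    show "\<one>\<^bsub>cgroup c\<^esub> \<in> H" by (simp add: H_def C.D_one[OF zero(1)])
  next
    show "H \<subseteq> carrier (cgroup c)" by (auto simp: H_def)
  next
    fix \<gamma> \<delta> assume "\<gamma> \<in> H" "\<delta> \<in> H"
    then show "\<gamma> \<otimes>\<^bsub>cgroup c\<^esub> \<delta> \<in> H" by (simp add: H_def C_mult)
  qed
  \<comment> \<open>For \<open>v\<close> in the kernel of \<open>f'\<close>, the inverse of
    \<open>\<gamma>\<close> keeps \<open>v\<close> in that kernel, \<open>h\<close> acts trivially
    there, and \<open>\<gamma>\<close> brings \<open>v\<close> back.\<close>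
  moreover have "\<gamma> \<otimes>\<^bsub>cgroup c\<^esub> h \<otimes>\<^bsub>cgroup c\<^esub> inv\<^bsub>cgroup c\<^esub> \<gamma> \<in> H"
    if "\<gamma> \<in> carrier (cgroup c)" "h \<in> H" for \<gamma> h
    using that ker[of "inv\<^bsub>cgroup c\<^esub> \<gamma>"] by (auto simp: H_def C_mult inv_D)
  ultimately interpret H: normal H "cgroup c"
    using C.normal_inv_iff by blast

  have trivial: "\<gamma> = \<one>\<^bsub>cgroup c\<^esub>"
    if \<gamma>: "\<gamma> \<in> carrier (cgroup c)" "\<Theta> \<gamma> = \<one>\<^bsub>cgroup d\<^esub>" "\<gamma> \<in> H" for \<gamma>
  proof (rule C.fixed_to_first_order_imp_one[OF B orbifold_chart_connected[OF oc] \<gamma>(1) zero(1)])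
    show "cact c \<gamma> 0 = 0" using zero(2) \<gamma>(1) .
    show "C.D \<gamma> 0 = (\<lambda>v. v)"
    proof (rule unipotent_finite_order_imp_id[OF C_lin[OF \<gamma>(1)]])
      have "0 \<in> cdom d" using od unfolding orbifold_chart_def by blast
      then have "f' (C.D \<gamma> 0 v - v) = 0" for v
        using f'_equi[OF \<gamma>(1)] \<gamma>(2) D.D_one by (simp add: f'.diff)
      then show "C.D \<gamma> 0 (C.D \<gamma> 0 v - v) = C.D \<gamma> 0 v - v" for v
        using \<gamma>(3) unfolding H_def by blast
      show "order (cgroup c) > 0"
        using C.finite_group by (simp add: C.order_gt_0_iff_finite)
      \<comment> \<open>By the chain rule at the fixed point 0, this iterate is the differential of
        a power of \<open>\<gamma>\<close> that equals the identity.\<close>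
      show "C.D \<gamma> 0 ^^ order (cgroup c) = (\<lambda>v. v)"
        using C.pow_fixed(2)[OF \<gamma>(1) zero(1) zero(2)[OF \<gamma>(1)], of "order (cgroup c)"]
          C.pow_order_eq_1[OF \<gamma>(1)] C.D_one[OF zero(1)] by simp
    qed
  qed

  let ?K = "kernel (cgroup c) (cgroup d) \<Theta>"
  interpret Q: group_hom "cgroup c" "cgroup c Mod H" "\<lambda>\<gamma>. H #>\<^bsub>cgroup c\<^esub> \<gamma>"
    using H.factorgroup_is_group H.r_coset_hom_Mod
    by (simp add: group_hom_def group_hom_axioms_def C.group_axioms)
  have "group ((cgroup c)\<lparr>carrier := ?K\<rparr>)"
    using \<Theta>.subgroup_kernel by (rule C.subgroup_imp_group)
  then have K: "group_hom ((cgroup c)\<lparr>carrier := ?K\<rparr>) (cgroup c Mod H) (\<lambda>\<gamma>. H #>\<^bsub>cgroup c\<^esub> \<gamma>)"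
    using Q.homh Q.H.group_axioms
    by (auto simp: group_hom_def group_hom_axioms_def hom_def kernel_def)
  have "inj_on (\<lambda>\<gamma>. H #>\<^bsub>cgroup c\<^esub> \<gamma>) ?K"
  proof (rule inj_onI)
    fix \<gamma> \<delta> assume *: "\<gamma> \<in> ?K" "\<delta> \<in> ?K" "H #>\<^bsub>cgroup c\<^esub> \<gamma> = H #>\<^bsub>cgroup c\<^esub> \<delta>"
    then have g: "\<gamma> \<in> carrier (cgroup c)" "\<delta> \<in> carrier (cgroup c)"
      "\<Theta> \<gamma> = \<one>\<^bsub>cgroup d\<^esub>" "\<Theta> \<delta> = \<one>\<^bsub>cgroup d\<^esub>"
      by (auto simp: kernel_def)
    \<comment> \<open>Equal cosets differ by some \<open>h\<close> in \<open>H\<close>. Since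
      \<open>\<Theta>\<close> kills both \<open>\<gamma>\<close> and \<open>\<delta>\<close>, it
      kills \<open>h\<close>, and \<open>trivial\<close> applies.\<close>
    obtain h where h: "h \<in> H" "\<delta> = h \<otimes>\<^bsub>cgroup c\<^esub> \<gamma>"
      using C.repr_independenceD[OF H.subgroup_axioms g(2) *(3)] unfolding r_coset_def by blast
    have hc: "h \<in> carrier (cgroup c)" using h(1) H.subset by blast
    then have "\<Theta> h = \<one>\<^bsub>cgroup d\<^esub>"
      using h(2) g by simp
    then have "h = \<one>\<^bsub>cgroup c\<^esub>" using trivial h(1) hc by blast
    then show "\<gamma> = \<delta>" using h(2) g by simp
  qed
  with K show ?thesis
    unfolding fibre_isotropy_def map_kernel_def H isotropy_def c_def d_def \<Theta>_def by auto
qed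

end
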